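(* Medoid Max Shift is consistent, in the following sense. Let $s>0$, let $x_*$ be a mode of $f$ and let $x_0\in\mathcal{U}_{2s}$ be in the basin of attraction of $x_*$. There are constants $C>0$ and $\tau>0$ such that, for any locally finite medoid set $\mathcal{Y}\subset\mathbb{R}^d$ and any $\varepsilon>0$ with $\varepsilon\le\tau$ and $\alpha_s/\varepsilon\le\tau$, medoid Max Shift with medoid set $\mathcal{Y}$ and neighborhood size $\varepsilon$, initialized at $x_0$, converges to a medoid point within distance $C(\alpha_s/\varepsilon+\varepsilon)$ of $x_*$. In particular, as $\alpha_s\to0$ and $\varepsilon\to0$ in such a way that $\alpha_s/\varepsilon\to0$, the limit point of the algorithm converges to $x_*$.
   Context: Density. $f$ is a probability density on $\mathbb{R}^d$ with respect to Lebesgue measure such that: (i) $f(x)\to0$ as $\|x\|\to\infty$; (ii) $f$ is twice differentiable everywhere, and $f$, $\nabla f$, $\nabla^2 f$ are bounded and uniformly continuous; (iii) the Hessian $\nabla^2 f$ is non-singular at every critical point of $f$. A mode is a local maximum of $f$. $\mathcal{U}_s=\{x:f(x)\ge s\}$. Gradient flow. For $x\in\mathbb{R}^d$, $\gamma_x:[0,\infty)\to\mathbb{R}^d$ is the solution of $\gamma_x(0)=x$, $\dot\gamma_x(t)=\nabla f(\gamma_x(t))$; $\gamma_x(t)$ converges to a critical point of $f$ as $t\to\infty$, denoted $\gamma_x(\infty)$. The basin of attraction of $x_*$ is $\{x:\gamma_x(\infty)=x_*\}$. Medoid Max Shift. Given a locally finite set $\mathcal{Y}$ (its elements are called medoid points),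 $\varepsilon>0$ and a starting point $x_0$: $x(0)=x_0$ and $x(k+1)\in\operatorname{arg\,max}_{y\in\mathcal{Y}\cap B(x(k),\varepsilon)}f(y)$ for $k\ge0$, where $B(x,\varepsilon)$ is the ball of radius $\varepsilon$ centered at $x$; ties are broken in a prescribed way, and if $f(x(k+1))=f(x(k))$ the process stops. A process that stops is said to converge to the point where it stops. Density of the medoid set. $\alpha_s:=\sup_{x\in\mathcal{U}_s}\inf_{y\in\mathcal{Y}}\|x-y\|$. *)

theory Defs
  imports "HOL-Analysis.Analysis"
begin

section \<open>Densities: derivatives, level sets, modes, gradient flow\<close>

definition prob_density :: "(real ^ 'n \<Rightarrow> real) \<Rightarrow> bool" where
  "prob_density f \<longleftrightarrow>
     f \<in> borel_measurable borel \<and> (\<forall>x. 0 \<le> f x) \<and> (\<integral>\<^sup>+ x. ennreal (f x) \<partial>lborel) = 1"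

text \<open>
  The two operators below are meaningful only where the derivatives exist; this is ensured
  by \<open>twice_differentiable\<close>.
\<close>

definition gradient :: "(real ^ 'n \<Rightarrow> real) \<Rightarrow> real ^ 'n \<Rightarrow> real ^ 'n" where
  "gradient f x = (THE v. GDERIV f x :> v)"

definition hessian :: "(real ^ 'n \<Rightarrow> real) \<Rightarrow> real ^ 'n \<Rightarrow> real ^ 'n ^ 'n" where
  "hessian f x = jacobian (gradient f) (at x)"

definition twice_differentiable :: "(real ^ 'n \<Rightarrow> real) \<Rightarrow> bool" where
  "twice_differentiable f \<longleftrightarrow>
     (\<forall>x. f differentiable (at x)) \<and> (\<forall>x. gradient f differentiable (at x))"

definition bounded_unif_cont :: "('a::metric_space \<Rightarrow> 'b::metric_space) \<Rightarrow> bool" where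
  "bounded_unif_cont g \<longleftrightarrow> bounded (range g) \<and> uniformly_continuous_on UNIV g"

definition critical_point :: "(real ^ 'n \<Rightarrow> real) \<Rightarrow> real ^ 'n \<Rightarrow> bool" where
  "critical_point f x \<longleftrightarrow> gradient f x = 0"

definition is_mode :: "(real ^ 'n \<Rightarrow> real) \<Rightarrow> real ^ 'n \<Rightarrow> bool" where
  "is_mode f x \<longleftrightarrow> (\<exists>r>0. \<forall>y\<in>ball x r. f y \<le> f x)"

definition upper_level_set :: "('a \<Rightarrow> real) \<Rightarrow> real \<Rightarrow> 'a set" where
  "upper_level_set f s = {x. s \<le> f x}"

definition gradient_flow_line ::
    "(real ^ 'n \<Rightarrow> real) \<Rightarrow> real ^ 'n \<Rightarrow> (real \<Rightarrow> real ^ 'n) \<Rightarrow> bool" where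
  "gradient_flow_line f x \<gamma> \<longleftrightarrow>
     \<gamma> 0 = x \<and> (\<forall>t\<ge>0. (\<gamma> has_vector_derivative gradient f (\<gamma> t)) (at t within {0..}))"

text \<open>
  When the gradient is Lipschitz, in particular when the Hessian is bounded, the flow line
  from \<open>x\<close> exists and is unique on \<open>[0, \<infinity>)\<close>, so the existential quantifier below merely
  names it.
\<close>

definition basin_of_attraction :: "(real ^ 'n \<Rightarrow> real) \<Rightarrow> real ^ 'n \<Rightarrow> (real ^ 'n) set" where
  "basin_of_attraction f x_star = {x. \<exists>\<gamma>. gradient_flow_line f x \<gamma> \<and> (\<gamma> \<longlongrightarrow> x_star) at_top}"


section \<open>Medoid sets\<close>

definition locally_finite :: "'a::metric_space set \<Rightarrow> bool" where
  "locally_finite Y \<longleftrightarrow> (\<forall>S. bounded S \<longrightarrow> finite (Y \<inter> S))"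

text \<open>
  The quantity \<open>\<alpha>\<^sub>s\<close>. It takes values in \<^typ>\<open>ennreal\<close> so that it is \<open>\<infinity>\<close> for an empty medoid
  set; the real-valued \<^const>\<open>infdist\<close> would be \<open>0\<close> there.
\<close>

definition medoid_gap ::
    "(real ^ 'n \<Rightarrow> real) \<Rightarrow> real \<Rightarrow> (real ^ 'n) set \<Rightarrow> ennreal" where
  "medoid_gap f s Y = (SUP x\<in>upper_level_set f s. INF y\<in>Y. ennreal (norm (x - y)))"


section \<open>Medoid Max Shift\<close>

definition mms_argmax ::
    "(real ^ 'n \<Rightarrow> real) \<Rightarrow> (real ^ 'n) set \<Rightarrow> real \<Rightarrow> real ^ 'n \<Rightarrow> (real ^ 'n) set" where
  "mms_argmax f Y \<epsilon> x = {y. is_arg_max f (\<lambda>z. z \<in> Y \<inter> cball x \<epsilon>) y}"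

text \<open>
  A tie-breaking rule picks an element of the set of maximizers; it may take the current
  iterate into account.
\<close>

definition tie_breaking_rule :: "('a \<Rightarrow> 'a set \<Rightarrow> 'a) \<Rightarrow> bool" where
  "tie_breaking_rule sel \<longleftrightarrow> (\<forall>x A. A \<noteq> {} \<longrightarrow> sel x A \<in> A)"

text \<open>
  The iterates, with stopping ignored. They are meaningful only as long as the sets of
  maximizers are nonempty, which \<open>mms_converges_to\<close> requires explicitly.
\<close>

primrec mms_iterate ::
    "(real ^ 'n \<Rightarrow> (real ^ 'n) set \<Rightarrow> real ^ 'n) \<Rightarrow> (real ^ 'n \<Rightarrow> real) \<Rightarrow> (real ^ 'n) set
      \<Rightarrow> real \<Rightarrow> real ^ 'n \<Rightarrow> nat \<Rightarrow> real ^ 'n" where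
  "mms_iterate sel f Y \<epsilon> x\<^sub>0 0 = x\<^sub>0"
| "mms_iterate sel f Y \<epsilon> x\<^sub>0 (Suc k) =
     sel (mms_iterate sel f Y \<epsilon> x\<^sub>0 k) (mms_argmax f Y \<epsilon> (mms_iterate sel f Y \<epsilon> x\<^sub>0 k))"

text \<open>
  The process stops the first time that \<open>f (x (Suc k)) = f (x k)\<close>, and the point where it
  stops is the last point that it has produced, \<open>x (Suc k)\<close>.
\<close>

definition mms_converges_to ::
    "(real ^ 'n \<Rightarrow> (real ^ 'n) set \<Rightarrow> real ^ 'n) \<Rightarrow> (real ^ 'n \<Rightarrow> real) \<Rightarrow> (real ^ 'n) set
      \<Rightarrow> real \<Rightarrow> real ^ 'n \<Rightarrow> real ^ 'n \<Rightarrow> bool" where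
  "mms_converges_to sel f Y \<epsilon> x\<^sub>0 p \<longleftrightarrow>
     (let x = mms_iterate sel f Y \<epsilon> x\<^sub>0 in
      \<exists>k. (\<forall>j\<le>k. mms_argmax f Y \<epsilon> (x j) \<noteq> {}) \<and>
          (\<forall>j<k. f (x (Suc j)) \<noteq> f (x j)) \<and>
          f (x (Suc k)) = f (x k) \<and>
          p = x (Suc k))"

lemma mms_converges_to_unique:
  assumes "mms_converges_to sel f Y \<epsilon> x\<^sub>0 p" "mms_converges_to sel f Y \<epsilon> x\<^sub>0 q"
  shows "p = q"
  using assms unfolding mms_converges_to_def Let_def
  by (metis linorder_neqE_nat)

end

theory Submission
  imports Defs
begin

text \<open>
Where the gradient is large compared with \<open>\<epsilon>\<close>, a step of the algorithm is almost the step of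
length \<open>\<epsilon>\<close> in the direction of the gradient: the medoids are dense at scale \<open>\<epsilon>\<close>, so one of them is
close to the endpoint of that step, and a maximizer of \<open>f\<close> in the ball of radius \<open>\<epsilon>\<close> must do at
least as well to first order (\<open>ascent_gain\<close>, \<open>step_direction\<close>). The iterates are therefore the
vertices of a slightly perturbed Euler polygon for the gradient flow and follow the flow line from
the starting point until it is close to the mode (\<open>euler_polygon_tracks_flow\<close>,
\<open>normalized_ascent_reaches_limit\<close>). The flow line does not meet a critical point before, unless it
is constant, by \<open>equilibrium_reached_imp_constant\<close>.

A nondegenerate local maximum has a neighbourhood that short steps not decreasing \<open>f\<close> cannot
leave (\<open>trapping_region\<close>). The algorithm stops, since otherwise \<open>f\<close> would strictly increase
along medoids in a bounded upper level set (\<open>terminates\<close>); and it stops inside this neighbourhood, at a point with a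
gradient of order \<open>\<epsilon>\<close>, because a larger gradient would force a strict gain
(\<open>stop_imp_small_gradient\<close>, \<open>converges_inside\<close>). By nondegeneracy the
distance to the mode is at most a multiple of the norm of the gradient (\<open>nondegenerate_zero_bounded_below\<close>), hence of order \<open>\<epsilon>\<close>. This is a little
better than the bound in terms of \<open>\<alpha>\<^sub>s / \<epsilon> + \<epsilon>\<close>; the ratio \<open>\<alpha>\<^sub>s / \<epsilon>\<close> only has to be small enough
for the tracking.
\<close>

section \<open>Functions with bounded Lipschitz gradient\<close>

locale lipschitz_gradient =
  fixes f :: "'a::euclidean_space \<Rightarrow> real" and g :: "'a \<Rightarrow> 'a" and M G :: real
  assumes gderiv: "GDERIV f x :> g x"
    and gradient_Lipschitz: "norm (g x - g y) \<le> M * norm (x - y)"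
    and gradient_bounded: "norm (g x) \<le> G"
    and M_pos: "0 < M"
    and G_pos: "0 < G"
begin

text \<open>
The first-order Taylor remainder is at most quadratic. The constant \<open>M\<close> in place of the sharp
\<open>M / 2\<close> comes from the plain mean value inequality; the argument is insensitive to it.
\<close>
lemma taylor: "\<bar>f y - f x - (y - x) \<bullet> g x\<bar> \<le> M * (norm (y - x))\<^sup>2"
proof -
  let ?S = "closed_segment x y"
  have "norm ((f y - y \<bullet> g x) - (f x - x \<bullet> g x)) \<le> (M * norm (y - x)) * norm (y - x)"
  proof (rule differentiable_bound[where S = ?S and f' = "\<lambda>z h. h \<bullet> g z - h \<bullet> g x"])
    fix z assume z: "z \<in> ?S"
    show "((\<lambda>z. f z - z \<bullet> g x) has_derivative (\<lambda>h. h \<bullet> g z - h \<bullet> g x)) (at z within ?S)"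
      using gderiv[of z] unfolding gderiv_def
      by (intro has_derivative_at_withinI[OF has_derivative_diff] has_derivative_inner_left has_derivative_ident)
    have "norm (z - x) \<le> norm (y - x)"
      using segment_bound(1)[OF z] by (simp add: norm_minus_commute)
    then have *: "norm (g z - g x) \<le> M * norm (y - x)"
      using M_pos by (intro order_trans[OF gradient_Lipschitz] mult_left_mono) auto
    show "onorm (\<lambda>h. h \<bullet> g z - h \<bullet> g x) \<le> M * norm (y - x)"
    proof (rule onorm_le)
      fix h
      have "norm (h \<bullet> g z - h \<bullet> g x) \<le> norm h * norm (g z - g x)"
        using Cauchy_Schwarz_ineq2[of h "g z - g x"] by (simp add: inner_diff_right)
      also have "\<dots> \<le> M * norm (y - x) * norm h"
        using mult_right_mono[OF *, of "norm h"] by (simp add: mult.commute)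
      finally show "norm (h \<bullet> g z - h \<bullet> g x) \<le> M * norm (y - x) * norm h" .
    qed
  qed auto
  moreover have "(f y - y \<bullet> g x) - (f x - x \<bullet> g x) = f y - f x - (y - x) \<bullet> g x"
    by (simp add: inner_diff_left)
  ultimately show ?thesis by (simp add: power2_eq_square mult.assoc)
qed

lemma f_Lipschitz: "\<bar>f y - f x\<bar> \<le> G * norm (y - x)"
proof -
  have "norm (f y - f x) \<le> G * norm (y - x)"
  proof (rule differentiable_bound[where S = UNIV and f' = "\<lambda>z h. h \<bullet> g z"])
    fix z
    show "(f has_derivative (\<lambda>h. h \<bullet> g z)) (at z within UNIV)"
      using gderiv[of z] unfolding gderiv_def by simp
    show "onorm (\<lambda>h. h \<bullet> g z) \<le> G"
    proof (rule onorm_le)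
      fix h
      show "norm (h \<bullet> g z) \<le> G * norm h"
        using Cauchy_Schwarz_ineq2[of h "g z"] mult_right_mono[OF gradient_bounded[of z], of "norm h"]
        by (simp add: mult.commute)
    qed
  qed auto
  then show ?thesis by simp
qed

lemma continuous_on_f: "continuous_on S f"
proof -
  have "(f has_derivative (\<lambda>h. h \<bullet> g x)) (at x)" for x
    using gderiv unfolding gderiv_def .
  then show ?thesis
    by (meson continuous_at_imp_continuous_on has_derivative_continuous)
qed

lemma local_max_critical:
  assumes "0 < r" "\<And>y. y \<in> ball x r \<Longrightarrow> f y \<le> f x"
  shows "g x = 0"
proof -
  have "(\<lambda>h. h \<bullet> g x) = (\<lambda>h. 0)"
    by (rule differential_zero_maxmin[of x "ball x r" f])
      (use assms gderiv[of x] in \<open>auto simp: gderiv_def\<close>)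
  then have "g x \<bullet> g x = 0" by metis
  then show ?thesis by simp
qed

text \<open>
The lower bound on \<open>g\<close> leaves no zero of \<open>g\<close> near the local maximum \<open>p\<close> except \<open>p\<close> itself. A
nearby point with the value \<open>f p\<close> would be a local maximum too, hence such a zero; so the
maximum is strict. Take a small ball around \<open>p\<close> and the part of it where \<open>f\<close> exceeds its
maximum \<open>m\<close> over a surrounding annulus. A step from there that does not decrease \<open>f\<close> cannot
end in the annulus, and a short step cannot jump across it.
\<close>
lemma trapping_region:
  assumes max: "0 < r0" "\<And>y. y \<in> ball p r0 \<Longrightarrow> f y \<le> f p"
    and c: "0 < c" "0 < r1" "\<And>x. x \<in> ball p r1 \<Longrightarrow> c * norm (x - p) \<le> norm (g x)"
  obtains W e where "open W" "p \<in> W" "0 < e" "W \<subseteq> ball p r1"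
    "\<And>x y. x \<in> W \<Longrightarrow> y \<in> cball x e \<Longrightarrow> f x \<le> f y \<Longrightarrow> y \<in> W"
proof -
  define r where "r = min r0 r1 / 2"
  have r: "0 < r" "r < r0" "r < r1" using max(1) c(2) by (auto simp: r_def)
  let ?A = "cball p r - ball p (r/2)"
  have less: "f y < f p" if y: "y \<in> ?A" for y
  proof (rule ccontr)
    assume "\<not> f y < f p"
    have *: "f z \<le> f y" if "z \<in> ball y (r0 - r)" for z
    proof -
      have "dist p z < r0"
        using that y dist_triangle[of p z y] by (auto simp: dist_commute)
      then show ?thesis using max(2)[of z] \<open>\<not> f y < f p\<close> by auto
    qed
    have "g y = 0" by (rule local_max_critical[of "r0 - r"]) (use r * in auto)
    moreover have "y \<in> ball p r1" using y r by auto
    ultimately have "c * norm (y - p) \<le> 0" using c(3)[of y] by simp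
    then have "y = p" using c(1) by (simp add: mult_le_0_iff)
    then show False using y r by simp
  qed
  obtain m where m: "m < f p" "\<And>y. y \<in> ?A \<Longrightarrow> f y \<le> m"
  proof (cases "?A = {}")
    case True
    show ?thesis by (rule that[of "f p - 1"]) (use True in auto)
  next
    case False
    have "compact ?A" by (simp add: compact_diff)
    then obtain q where "q \<in> ?A" "\<And>y. y \<in> ?A \<Longrightarrow> f y \<le> f q"
      using continuous_attains_sup[OF _ False continuous_on_f] by blast
    then show ?thesis using that[of "f q"] less by blast
  qed
  define W where "W = ball p (r/2) \<inter> {x. m < f x}"
  show thesis
  proof (rule that[of W "r/2"])
    show "open W" unfolding W_def
      by (intro open_Int open_ball open_Collect_less continuous_on_f continuous_intros)
    show "p \<in> W" using r m by (simp add: W_def)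
    show "W \<subseteq> ball p r1" using r by (auto simp: W_def)
    fix x y assume x: "x \<in> W" and y: "y \<in> cball x (r/2)" and le: "f x \<le> f y"
    have "dist p y \<le> r" using x y dist_triangle[of p y x] by (auto simp: W_def)
    moreover have "m < f y" using x le by (simp add: W_def)
    ultimately show "y \<in> W" using m(2)[of y] by (auto simp: W_def)
  qed (use r in auto)
qed

end

section \<open>Tracking flow lines by perturbed Euler polygons\<close>

text \<open>
With \<open>v t = (norm (\<gamma> t - z))\<^sup>2\<close> one has \<open>\<bar>v'\<bar> \<le> 2 M v\<close>, so \<open>v t * exp (2 M t)\<close> is
nondecreasing and \<open>v t * exp (- 2 M t)\<close> is nonincreasing. The former controls the times before
the hitting time, the latter those after it. This is what keeps a nonconstant flow line at a
positive speed on compact time intervals.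
\<close>
lemma equilibrium_reached_imp_constant:
  fixes \<gamma> :: "real \<Rightarrow> 'a::real_inner"
  assumes ode: "\<And>t. 0 \<le> t \<Longrightarrow> (\<gamma> has_vector_derivative F (\<gamma> t)) (at t within {0..})"
    and lin: "\<And>y. norm (F y) \<le> M * norm (y - z)"
    and hit: "0 \<le> c" "\<gamma> c = z" and t: "0 \<le> t"
  shows "\<gamma> t = z"
proof -
  define u where "u \<sigma> t = (norm (\<gamma> t - z))\<^sup>2 * exp (\<sigma> * 2 * M * t)" for \<sigma> t :: real
  define d where "d \<sigma> t = 2 * ((\<gamma> t - z) \<bullet> F (\<gamma> t) + \<sigma> * M * (norm (\<gamma> t - z))\<^sup>2) * exp (\<sigma> * 2 * M * t)"
    for \<sigma> t :: real
  have cont: "continuous_on {a..b} (u \<sigma>)" if "0 \<le> a" for a b \<sigma>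
  proof -
    have "continuous_on {0..} \<gamma>"
      using ode by (auto simp: continuous_on_eq_continuous_within
          intro: has_vector_derivative_continuous)
    then have "continuous_on {a..b} \<gamma>" by (rule continuous_on_subset) (use that in auto)
    then show ?thesis unfolding u_def by (intro continuous_intros)
  qed
  have der: "(u \<sigma> has_derivative (\<lambda>h. h * d \<sigma> x)) (at x)" if "0 < x" for x \<sigma>
  proof -
    have "(\<gamma> has_vector_derivative F (\<gamma> x)) (at x within {0<..})"
      using ode[of x] that by (auto intro: has_vector_derivative_within_subset)
    then have "(\<gamma> has_vector_derivative F (\<gamma> x)) (at x)"
      using that by (simp add: has_vector_derivative_def at_within_open[of x "{0<..}"])
    then show ?thesis unfolding u_def d_def has_vector_derivative_def power2_norm_eq_inner
      by (auto intro!: derivative_eq_intros simp: algebra_simps inner_commute)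
  qed
  have inn: "\<bar>(\<gamma> t - z) \<bullet> F (\<gamma> t)\<bar> \<le> M * (norm (\<gamma> t - z))\<^sup>2" for t
  proof -
    have "\<bar>(\<gamma> t - z) \<bullet> F (\<gamma> t)\<bar> \<le> norm (\<gamma> t - z) * norm (F (\<gamma> t))" by (rule Cauchy_Schwarz_ineq2)
    also have "\<dots> \<le> norm (\<gamma> t - z) * (M * norm (\<gamma> t - z))"
      by (intro mult_left_mono lin) simp
    finally show ?thesis by (simp add: power2_eq_square mult_ac)
  qed
  have u0: "u \<sigma> c = 0" for \<sigma> using hit by (simp add: u_def)
  have "u 1 t = 0 \<or> u (-1) t = 0"
  proof (cases t c rule: linorder_cases)
    case less
    have "\<exists>x\<in>{t<..<c}. u 1 c - u 1 t = (c - t) * d 1 x"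
      by (rule mvt[OF less cont[OF t]]) (use der t in auto)
    then obtain x where "u 1 c - u 1 t = (c - t) * d 1 x" by blast
    moreover have "0 \<le> d 1 x" using inn[of x] by (simp add: d_def)
    moreover have "0 \<le> u 1 t" by (simp add: u_def)
    ultimately show ?thesis using less u0[of 1] by (smt (verit) mult_nonneg_nonneg)
  next
    case equal then show ?thesis using u0 by simp
  next
    case greater
    have "\<exists>x\<in>{c<..<t}. u (-1) t - u (-1) c = (t - c) * d (-1) x"
      by (rule mvt[OF greater cont[OF hit(1)]]) (use der hit in auto)
    then obtain x where "u (-1) t - u (-1) c = (t - c) * d (-1) x" by blast
    moreover have "d (-1) x \<le> 0" using inn[of x] by (simp add: d_def mult_le_0_iff)
    moreover have "0 \<le> u (-1) t" by (simp add: u_def)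
    ultimately show ?thesis using greater u0[of "-1"] by (smt (verit) mult_nonneg_nonpos)
  qed
  then show ?thesis by (simp add: u_def)
qed

text \<open>
Gronwall's argument for Euler polygons with variable steps: \<open>\<eta>\<close> is the defect per unit of time
of the polygon, \<open>M * G * h_max\<close> that of the Euler scheme itself, and defects accumulate by the
factor \<open>exp (M * T)\<close>. The steps are controlled only where the speed is at least \<open>c\<close>. Since
the flow line has speed at least \<open>2 * c\<close>, closeness to it implies this bound at the next vertex,
so closeness and control of the steps are obtained in a single induction. Steps of at least
\<open>h_min\<close> ensure that the time \<open>T\<close> is passed after finitely many of them.
\<close>
lemma euler_polygon_tracks_flow:
  fixes \<gamma> :: "real \<Rightarrow> 'a::real_inner" and x :: "nat \<Rightarrow> 'a"
  assumes Lip: "\<And>y z. norm (F y - F z) \<le> M * norm (y - z)" and bdd: "\<And>y. norm (F y) \<le> G"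
    and pos: "0 < M" "0 < G" "0 \<le> T"
    and ode: "\<And>t. 0 \<le> t \<Longrightarrow> (\<gamma> has_vector_derivative F (\<gamma> t)) (at t within {0..})"
    and start: "x 0 = \<gamma> 0"
    and speed: "\<And>t. 0 \<le> t \<Longrightarrow> t \<le> T \<Longrightarrow> 2 * c \<le> norm (F (\<gamma> t))"
    and step: "\<And>k. c \<le> norm (F (x k)) \<Longrightarrow> h_min \<le> h k \<and> h k \<le> h_max \<and>
                  norm (x (Suc k) - x k - h k *\<^sub>R F (x k)) \<le> h k * \<eta>"
    and h_min: "0 < h_min" and c_nonneg: "0 \<le> c" and \<eta>: "0 \<le> \<eta>"
    and small: "exp (M * T) * (\<eta> + M * G * h_max) \<le> M * \<rho>" "M * \<rho> \<le> c"
  shows "\<exists>k. norm (x k - \<gamma> T) \<le> \<rho> + G * h_max \<and> (\<forall>j\<le>k. c \<le> norm (F (x j)))"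
proof -
  have flow_Lip: "norm (\<gamma> b - \<gamma> a) \<le> G * (b - a)" if "0 \<le> a" "a \<le> b" for a b
  proof -
    have "norm (\<gamma> b - \<gamma> a) \<le> G * norm (b - a)"
    proof (rule differentiable_bound[where S = "{a..b}" and f' = "\<lambda>t h. h *\<^sub>R F (\<gamma> t)"])
      fix t assume t: "t \<in> {a..b}"
      show "(\<gamma> has_derivative (\<lambda>h. h *\<^sub>R F (\<gamma> t))) (at t within {a..b})"
        using ode[of t] t that unfolding has_vector_derivative_def
        by (auto intro: has_derivative_subset)
      show "onorm (\<lambda>h. h *\<^sub>R F (\<gamma> t)) \<le> G"
        using mult_left_mono[OF bdd[of "\<gamma> t"] abs_ge_zero] by (intro onorm_le) (simp add: mult.commute)
    qed (use that in auto)
    then show ?thesis using that by simp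
  qed
  have euler: "norm (\<gamma> (a + h) - \<gamma> a - h *\<^sub>R F (\<gamma> a)) \<le> M * G * h * h" if "0 \<le> a" "0 \<le> h" for a h
  proof -
    have "norm ((\<gamma> (a + h) - (a + h) *\<^sub>R F (\<gamma> a)) - (\<gamma> a - a *\<^sub>R F (\<gamma> a))) \<le> (M * G * h) * norm ((a + h) - a)"
    proof (rule differentiable_bound[where S = "{a..a+h}" and f' = "\<lambda>t h. h *\<^sub>R (F (\<gamma> t) - F (\<gamma> a))"])
      fix t assume t: "t \<in> {a..a+h}"
      have "(\<gamma> has_derivative (\<lambda>h. h *\<^sub>R F (\<gamma> t))) (at t within {a..a+h})"
        using ode[of t] t that unfolding has_vector_derivative_def
        by (auto intro: has_derivative_subset)
      then show "((\<lambda>t. \<gamma> t - t *\<^sub>R F (\<gamma> a)) has_derivative (\<lambda>h. h *\<^sub>R (F (\<gamma> t) - F (\<gamma> a)))) (at t within {a..a+h})"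
        using has_derivative_diff[OF _ has_derivative_scaleR_left[OF has_derivative_ident], of \<gamma>]
        by (simp add: scaleR_diff_right)
      have "norm (F (\<gamma> t) - F (\<gamma> a)) \<le> M * norm (\<gamma> t - \<gamma> a)" by (rule Lip)
      also have "\<dots> \<le> M * (G * (t - a))" using flow_Lip[of a t] t that pos by (simp add: mult_left_mono)
      also have "\<dots> \<le> M * (G * h)" using t pos by (simp add: mult_left_mono)
      finally have "norm (F (\<gamma> t) - F (\<gamma> a)) \<le> M * G * h" by (simp add: mult.assoc)
      from mult_left_mono[OF this abs_ge_zero]
      show "onorm (\<lambda>h. h *\<^sub>R (F (\<gamma> t) - F (\<gamma> a))) \<le> M * G * h"
        by (intro onorm_le) (simp add: mult.commute)
    qed (use that in auto)
    then show ?thesis using that by (simp add: algebra_simps)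
  qed
  define t where "t k = (\<Sum>j<k. h j)" for k
  define B where "B = \<eta> + M * G * h_max"
  have t_Suc: "t (Suc k) = t k + h k" for k by (simp add: t_def)
  have exp_T: "exp (M * r) \<le> exp (M * T)" if "r \<le> T" for r using that pos by simp
  have track: "norm (x k - \<gamma> (t k)) * M \<le> (exp (M * t k) - 1) * B \<and> 0 \<le> t k \<and>
     (\<forall>j\<le>k. c \<le> norm (F (x j)))" if "t k \<le> T" "\<forall>j<k. t j \<le> T" for k
    using that
  proof (induction k)
    case 0
    have "0 \<le> c" using c_nonneg .
    then have "c \<le> norm (F (\<gamma> 0))" using speed[of 0] pos by simp
    then show ?case using start by (simp add: t_def)
  next
    case (Suc k)
    from Suc have IH: "norm (x k - \<gamma> (t k)) * M \<le> (exp (M * t k) - 1) * B" "0 \<le> t k"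
      "\<forall>j\<le>k. c \<le> norm (F (x j))" by auto
    have h: "h_min \<le> h k" "h k \<le> h_max" "norm (x (Suc k) - x k - h k *\<^sub>R F (x k)) \<le> h k * \<eta>"
      using step[of k] IH(3) by auto
    then have hpos: "0 < h k" using h_min by simp
    have B: "0 \<le> B" unfolding B_def using \<eta> pos hpos h by simp
    have "x (Suc k) - \<gamma> (t k + h k) = (x k - \<gamma> (t k)) + h k *\<^sub>R (F (x k) - F (\<gamma> (t k)))
        + (x (Suc k) - x k - h k *\<^sub>R F (x k)) - (\<gamma> (t k + h k) - \<gamma> (t k) - h k *\<^sub>R F (\<gamma> (t k)))"
      by (simp add: algebra_simps)
    then have "norm (x (Suc k) - \<gamma> (t (Suc k))) \<le> norm (x k - \<gamma> (t k)) + norm (h k *\<^sub>R (F (x k) - F (\<gamma> (t k))))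
        + norm (x (Suc k) - x k - h k *\<^sub>R F (x k)) + norm (\<gamma> (t k + h k) - \<gamma> (t k) - h k *\<^sub>R F (\<gamma> (t k)))"
      unfolding t_Suc by (smt (verit) norm_triangle_ineq norm_triangle_ineq4)
    also have "\<dots> \<le> norm (x k - \<gamma> (t k)) + h k * (M * norm (x k - \<gamma> (t k))) + h k * \<eta> + M * G * h k * h k"
      using h(3) euler[OF IH(2), of "h k"] hpos Lip[of "x k" "\<gamma> (t k)"]
      by (intro add_mono) (auto intro: mult_left_mono)
    also have "\<dots> \<le> norm (x k - \<gamma> (t k)) + h k * (M * norm (x k - \<gamma> (t k))) + h k * \<eta> + M * G * h k * h_max"
      using h hpos pos by (intro add_mono mult_left_mono) auto
    also have "\<dots> = (1 + M * h k) * norm (x k - \<gamma> (t k)) + h k * B"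
      by (simp add: B_def algebra_simps)
    finally have "norm (x (Suc k) - \<gamma> (t (Suc k))) * M \<le> ((1 + M * h k) * norm (x k - \<gamma> (t k)) + h k * B) * M"
      using pos by (intro mult_right_mono) auto
    also have "\<dots> = (1 + M * h k) * (norm (x k - \<gamma> (t k)) * M) + M * h k * B" by (simp add: algebra_simps)
    also have "\<dots> \<le> (1 + M * h k) * ((exp (M * t k) - 1) * B) + M * h k * B"
      using IH(1) hpos pos by (intro add_mono mult_left_mono) auto
    also have "\<dots> = ((1 + M * h k) * exp (M * t k) - 1) * B" by (simp add: algebra_simps)
    also have "\<dots> \<le> (exp (M * h k) * exp (M * t k) - 1) * B"
      using B exp_ge_add_one_self[of "M * h k"] by (intro mult_right_mono) auto
    also have "\<dots> = (exp (M * t (Suc k)) - 1) * B" by (simp add: t_Suc exp_add algebra_simps)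
    finally have 1: "norm (x (Suc k) - \<gamma> (t (Suc k))) * M \<le> (exp (M * t (Suc k)) - 1) * B" .
    have 2: "0 \<le> t (Suc k)" using IH hpos by (simp add: t_Suc)
    have "(exp (M * t (Suc k)) - 1) * B \<le> exp (M * T) * B"
      using B exp_T[OF Suc.prems(1)] by (intro mult_right_mono; linarith)
    then have "norm (x (Suc k) - \<gamma> (t (Suc k))) * M \<le> c" using 1 small by (simp add: B_def)
    then have "norm (F (x (Suc k)) - F (\<gamma> (t (Suc k)))) \<le> c"
      using Lip[of "x (Suc k)" "\<gamma> (t (Suc k))"] by (simp add: mult.commute)
    then have "c \<le> norm (F (x (Suc k)))"
      using speed[OF 2] Suc.prems norm_triangle_ineq2[of "F (\<gamma> (t (Suc k)))" "F (x (Suc k))"]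
      by (simp add: norm_minus_commute)
    then show ?case using 1 2 IH(3) le_Suc_eq by auto
  qed
  have "\<exists>k. T < t k"
  proof (rule ccontr)
    assume "\<not> (\<exists>k. T < t k)"
    then have le: "t k \<le> T" for k by (auto simp: not_less)
    then have "h_min \<le> h k" for k using track[of k] step[of k] by auto
    then have "(\<Sum>j<k. h_min) \<le> t k" for k unfolding t_def by (intro sum_mono) auto
    then have "real k * h_min \<le> T" for k using order_trans[OF _ le[of k], of "\<Sum>j<k. h_min"] by simp
    moreover obtain k where "T < real k * h_min" using ex_less_of_nat_mult[OF h_min] by auto
    ultimately show False by (meson not_le)
  qed
  then obtain n where n: "T < t n" "\<And>j. j < n \<Longrightarrow> t j \<le> T"
    using exists_least_iff[of "\<lambda>k. T < t k"] by (auto simp: not_less)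
  have "n \<noteq> 0" using n(1) pos by (intro notI) (simp add: t_def)
  then obtain k where k: "n = Suc k" using not0_implies_Suc by blast
  have tr: "norm (x k - \<gamma> (t k)) * M \<le> (exp (M * t k) - 1) * B" "0 \<le> t k"
     "\<forall>j\<le>k. c \<le> norm (F (x j))" and tk: "t k \<le> T" using track[of k] n k by auto
  have h: "0 < h k" "h k \<le> h_max" using step[of k] tr h_min by auto
  have B: "0 \<le> B" unfolding B_def using \<eta> pos h by simp
  have "(exp (M * t k) - 1) * B \<le> exp (M * T) * B"
    using B exp_T[OF tk] by (intro mult_right_mono; linarith)
  then have "norm (x k - \<gamma> (t k)) * M \<le> \<rho> * M" using tr(1) small by (simp add: B_def mult.commute)
  then have "norm (x k - \<gamma> (t k)) \<le> \<rho>" using pos by simp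
  moreover have "norm (\<gamma> T - \<gamma> (t k)) \<le> G * h_max"
  proof -
    have "norm (\<gamma> T - \<gamma> (t k)) \<le> G * (T - t k)" using flow_Lip tr tk by blast
    also have "\<dots> \<le> G * h_max" using n(1) k h pos by (intro mult_left_mono) (auto simp: t_Suc)
    finally show ?thesis .
  qed
  ultimately have "norm (x k - \<gamma> T) \<le> \<rho> + G * h_max"
    using norm_triangle_ineq4[of "x k - \<gamma> (t k)" "\<gamma> T - \<gamma> (t k)"] by simp
  then show ?thesis using tr(3) by blast
qed

text \<open>
A step of length \<open>\<epsilon>\<close> in the direction of the gradient is an Euler step for the gradient flow of
duration \<open>\<epsilon>\<close> divided by the norm of the gradient. Hence sequences with almost such steps follow
the flow line up to a time at which it is close to its limit. Only accuracy \<open>\<epsilon> * \<delta>\<close> with a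
fixed small \<open>\<delta>\<close> is needed, because it is enough to enter a fixed neighbourhood of the limit.
\<close>
lemma (in lipschitz_gradient) normalized_ascent_reaches_limit:
  assumes ode: "\<And>t. 0 \<le> t \<Longrightarrow> (\<gamma> has_vector_derivative g (\<gamma> t)) (at t within {0..})"
    and lim: "(\<gamma> \<longlongrightarrow> p) at_top" and w: "0 < w"
  obtains c \<delta> \<tau> where "0 < c" "0 < \<delta>" "0 < \<tau>"
    "\<And>\<epsilon> x. 0 < \<epsilon> \<Longrightarrow> \<epsilon> \<le> \<tau> \<Longrightarrow> x 0 = \<gamma> 0 \<Longrightarrow>
       (\<And>k. c \<le> norm (g (x k)) \<Longrightarrow> norm (x (Suc k) - x k - \<epsilon> *\<^sub>R sgn (g (x k))) \<le> \<epsilon> * \<delta>) \<Longrightarrow>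
       \<exists>k. norm (x k - p) < w \<and> (\<forall>j<k. c \<le> norm (g (x j)))"
proof (cases "\<gamma> 0 = p")
  case True
  show thesis
    by (rule that[of 1 1 1]) (use True w in \<open>auto intro!: exI[of _ "0::nat"]\<close>)
next
  case False
  have noncrit: "g (\<gamma> t) \<noteq> 0" if "0 \<le> t" for t
  proof
    assume crit: "g (\<gamma> t) = 0"
    have const: "\<gamma> r = \<gamma> t" if "0 \<le> r" for r
      by (rule equilibrium_reached_imp_constant[OF ode, where M = M and c = t])
        (use gradient_Lipschitz[of _ "\<gamma> t"] crit that \<open>0 \<le> t\<close> in auto)
    then have "(\<gamma> \<longlongrightarrow> \<gamma> t) at_top"
      by (intro tendsto_eventually) (auto simp: eventually_at_top_linorder)
    then have "\<gamma> t = p" using lim by (rule tendsto_unique[OF trivial_limit_at_top_linorder])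
    then show False using const[of 0] False by simp
  qed
  have "\<forall>\<^sub>F t in at_top. dist (\<gamma> t) p < w / 2 \<and> 0 \<le> t"
    by (intro eventually_conj tendstoD[OF lim] eventually_ge_at_top) (use w in auto)
  then obtain T where T: "dist (\<gamma> T) p < w / 2" "0 \<le> T"
    using eventually_happens'[OF trivial_limit_at_top_linorder] by blast
  have "continuous_on {0..} \<gamma>"
    using ode by (auto simp: continuous_on_eq_continuous_within
        intro: has_vector_derivative_continuous)
  then have cont_\<gamma>: "continuous_on {0..T} \<gamma>" by (rule continuous_on_subset) auto
  have cont_g: "continuous_on UNIV g"
    by (rule lipschitz_on_continuous_on[of M])
      (use gradient_Lipschitz M_pos in \<open>auto simp: lipschitz_on_def dist_norm\<close>)
  have "continuous_on {0..T} (\<lambda>t. norm (g (\<gamma> t)))"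
    by (intro continuous_on_norm continuous_on_compose2[OF cont_g cont_\<gamma>]) auto
  then obtain t0 where t0: "t0 \<in> {0..T}" "\<And>t. t \<in> {0..T} \<Longrightarrow> norm (g (\<gamma> t0)) \<le> norm (g (\<gamma> t))"
    using continuous_attains_inf[of "{0..T}" "\<lambda>t. norm (g (\<gamma> t))"] T(2) by auto
  define c where "c = norm (g (\<gamma> t0)) / 2"
  have c: "0 < c" using noncrit[of t0] t0 by (simp add: c_def)
  define \<rho> where "\<rho> = min (c / M) (w / 4)"
  have \<rho>: "0 < \<rho>" "M * \<rho> \<le> c" "\<rho> \<le> w / 4"
    using c w M_pos by (auto simp: \<rho>_def min_def field_simps)
  \<comment> \<open>The two kinds of defect each use half of the admissible \<open>M * \<rho>\<close>.\<close>
  define \<delta> where "\<delta> = M * \<rho> / (2 * exp (M * T) * G)"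
  have \<delta>: "0 < \<delta>" using M_pos G_pos \<rho> by (simp add: \<delta>_def)
  define \<tau> where "\<tau> = min (c * \<rho> / (2 * exp (M * T) * G)) (c * w / (4 * G))"
  have \<tau>: "0 < \<tau>" using c w G_pos \<rho> by (simp add: \<tau>_def)
  show thesis
  proof (rule that[OF c \<delta> \<tau>])
    fix \<epsilon> :: real and x :: "nat \<Rightarrow> 'a"
    assume \<epsilon>: "0 < \<epsilon>" "\<epsilon> \<le> \<tau>" and x0: "x 0 = \<gamma> 0"
      and dir: "\<And>k. c \<le> norm (g (x k)) \<Longrightarrow> norm (x (Suc k) - x k - \<epsilon> *\<^sub>R sgn (g (x k))) \<le> \<epsilon> * \<delta>"
    have "\<exists>k. norm (x k - \<gamma> T) \<le> \<rho> + G * (\<epsilon> / c) \<and> (\<forall>j\<le>k. c \<le> norm (g (x j)))"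
    proof (rule euler_polygon_tracks_flow[where F = g and \<gamma> = \<gamma> and x = x and c = c
          and h = "\<lambda>k. \<epsilon> / norm (g (x k))" and h_min = "\<epsilon> / G" and \<eta> = "G * \<delta>",
          OF gradient_Lipschitz gradient_bounded M_pos G_pos T(2) ode x0])
      show "2 * c \<le> norm (g (\<gamma> t))" if "0 \<le> t" "t \<le> T" for t
        using t0(2)[of t] that by (simp add: c_def)
      fix k assume k: "c \<le> norm (g (x k))"
      then have pos: "0 < norm (g (x k))" using c by linarith
      have "\<epsilon> * \<delta> = \<epsilon> / norm (g (x k)) * (norm (g (x k)) * \<delta>)" using pos by simp
      also have "\<dots> \<le> \<epsilon> / norm (g (x k)) * (G * \<delta>)"
        using gradient_bounded[of "x k"] \<epsilon> \<delta> by (intro mult_left_mono mult_right_mono) auto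
      finally show "\<epsilon> / G \<le> \<epsilon> / norm (g (x k)) \<and> \<epsilon> / norm (g (x k)) \<le> \<epsilon> / c \<and>
          norm (x (Suc k) - x k - (\<epsilon> / norm (g (x k))) *\<^sub>R g (x k)) \<le> \<epsilon> / norm (g (x k)) * (G * \<delta>)"
        using dir[OF k] k c pos \<epsilon> gradient_bounded[of "x k"]
        by (auto simp: sgn_div_norm divide_inverse_commute mult.commute intro!: divide_left_mono)
    next
      have "exp (M * T) * (G * \<delta>) = M * \<rho> / 2" using G_pos by (simp add: \<delta>_def)
      moreover have "exp (M * T) * (M * G * (\<epsilon> / c)) \<le> M * \<rho> / 2"
      proof -
        have "\<epsilon> \<le> c * \<rho> / (2 * exp (M * T) * G)" using \<epsilon> by (simp add: \<tau>_def)
        then have "2 * exp (M * T) * G * \<epsilon> \<le> c * \<rho>" using G_pos by (simp add: pos_le_divide_eq mult_ac)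
        then have "M * (2 * exp (M * T) * G * \<epsilon>) \<le> M * (c * \<rho>)" using M_pos by simp
        then show ?thesis using c by (simp add: field_simps)
      qed
      ultimately show "exp (M * T) * (G * \<delta> + M * G * (\<epsilon> / c)) \<le> M * \<rho>"
        unfolding distrib_left by linarith
    qed (use \<epsilon> c \<rho> \<delta> G_pos in auto)
    then obtain k where k: "norm (x k - \<gamma> T) \<le> \<rho> + G * (\<epsilon> / c)" "\<forall>j\<le>k. c \<le> norm (g (x j))" by blast
    have "\<epsilon> \<le> c * w / (4 * G)" using \<epsilon> by (simp add: \<tau>_def)
    then have "G * (\<epsilon> / c) \<le> w / 4" using c G_pos by (simp add: field_simps)
    moreover have "norm (x k - p) \<le> norm (x k - \<gamma> T) + norm (\<gamma> T - p)"
      using norm_triangle_ineq[of "x k - \<gamma> T" "\<gamma> T - p"] by simp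
    ultimately have "norm (x k - p) < w"
      using k(1) \<rho>(3) T(1) unfolding dist_norm by linarith
    then show "\<exists>k. norm (x k - p) < w \<and> (\<forall>j<k. c \<le> norm (g (x j)))"
      using k(2) by auto
  qed
qed

section \<open>The medoid iteration\<close>

locale mms_run = lipschitz_gradient f "gradient f" M G
  for f :: "real ^ 'n \<Rightarrow> real" and M G :: real +
  fixes Y :: "(real ^ 'n) set" and sel :: "real ^ 'n \<Rightarrow> (real ^ 'n) set \<Rightarrow> real ^ 'n"
    and \<epsilon> \<beta> s :: real and x\<^sub>0 :: "real ^ 'n"
  assumes locally_finite: "locally_finite Y"
    and tie_breaking: "tie_breaking_rule sel"
    and eps_pos: "0 < \<epsilon>"
    and beta: "0 \<le> \<beta>" "\<beta> \<le> 1 / 8"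
    and bounded_level: "bounded (upper_level_set f s)"
    and covering: "x \<in> upper_level_set f s \<Longrightarrow> \<exists>y\<in>Y. norm (x - y) \<le> \<beta> * \<epsilon>"
    and start: "s + G * \<epsilon> \<le> f x\<^sub>0"
begin

abbreviation X :: "nat \<Rightarrow> real ^ 'n" where
  "X \<equiv> mms_iterate sel f Y \<epsilon> x\<^sub>0"

lemma mms_argmax_iff:
  "y \<in> mms_argmax f Y \<epsilon> z \<longleftrightarrow>
     y \<in> Y \<and> y \<in> cball z \<epsilon> \<and> (\<forall>y'\<in>Y \<inter> cball z \<epsilon>. f y' \<le> f y)"
  by (auto simp: mms_argmax_def is_arg_max_linorder)

lemma mms_argmax_nonempty:
  assumes "z \<in> upper_level_set f s"
  shows "mms_argmax f Y \<epsilon> z \<noteq> {}"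
proof -
  have fin: "finite (Y \<inter> cball z \<epsilon>)"
    using locally_finite by (simp add: locally_finite_def)
  obtain y where y: "y \<in> Y" "norm (z - y) \<le> \<beta> * \<epsilon>" using covering[OF assms] by blast
  have "\<beta> * \<epsilon> \<le> \<epsilon>" using beta eps_pos by (simp add: mult_le_cancel_right1)
  then have ne: "Y \<inter> cball z \<epsilon> \<noteq> {}" using y by (auto simp: dist_norm)
  have "Max (f ` (Y \<inter> cball z \<epsilon>)) \<in> f ` (Y \<inter> cball z \<epsilon>)"
    using fin ne by (intro Max_in) auto
  then obtain m where "m \<in> Y \<inter> cball z \<epsilon>" "f m = Max (f ` (Y \<inter> cball z \<epsilon>))" by auto
  then have "m \<in> mms_argmax f Y \<epsilon> z" using fin by (auto simp: mms_argmax_iff)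
  then show ?thesis by blast
qed

lemma Suc_in_argmax: "X k \<in> upper_level_set f s \<Longrightarrow> X (Suc k) \<in> mms_argmax f Y \<epsilon> (X k)"
  using mms_argmax_nonempty tie_breaking by (auto simp: tie_breaking_rule_def)

text \<open>
The starting point need not be a medoid, so that \<open>f\<close> may decrease in the first step, by at most
\<open>G * \<epsilon>\<close>; this loss is the reason for the margin in the assumption \<open>start\<close>. Later iterates are
medoids and compete in their own neighbourhood.
\<close>
lemma iterate_invariant: "X k \<in> upper_level_set f s \<and> (0 < k \<longrightarrow> X k \<in> Y)"
proof (induction k)
  case 0
  have "0 \<le> G * \<epsilon>" using G_pos eps_pos by simp
  then show ?case using start by (simp add: upper_level_set_def)
next
  case (Suc k)
  then have X: "X (Suc k) \<in> Y" "norm (X (Suc k) - X k) \<le> \<epsilon>"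
    "\<And>y. y \<in> Y \<inter> cball (X k) \<epsilon> \<Longrightarrow> f y \<le> f (X (Suc k))"
    using Suc_in_argmax[of k] by (auto simp: mms_argmax_iff dist_norm norm_minus_commute)
  have "s \<le> f (X (Suc k))"
  proof (cases "k = 0")
    case True
    have "G * norm (X (Suc k) - X k) \<le> G * \<epsilon>" using X(2) G_pos by (intro mult_left_mono) auto
    then show ?thesis using f_Lipschitz[of "X (Suc k)" "X k"] start True by simp
  next
    case False
    then show ?thesis using Suc X(3)[of "X k"] eps_pos by (auto simp: upper_level_set_def)
  qed
  then show ?case using X(1) by (auto simp: upper_level_set_def)
qed

lemma
  shows X_level: "X k \<in> upper_level_set f s"
    and X_medoid: "X (Suc k) \<in> Y"
    and X_step: "norm (X (Suc k) - X k) \<le> \<epsilon>"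
    and X_max: "y \<in> Y \<Longrightarrow> norm (y - X k) \<le> \<epsilon> \<Longrightarrow> f y \<le> f (X (Suc k))"
  using iterate_invariant[of k] iterate_invariant[of "Suc k"] Suc_in_argmax[of k]
  by (auto simp: mms_argmax_iff dist_norm norm_minus_commute simp del: mms_iterate.simps)

lemma X_mono: "0 < k \<Longrightarrow> f (X k) \<le> f (X (Suc k))"
  using X_max[of "X k" k] iterate_invariant[of k] eps_pos by simp

text \<open>
Compare the maximizer with a medoid close to the point at distance \<open>(1 - \<beta>) * \<epsilon>\<close> in the
direction of the gradient. This point lies in the upper level set because the gradient is at
least \<open>2 * M * \<epsilon>\<close>, so it has a medoid within \<open>\<beta> * \<epsilon>\<close>, which is within \<open>\<epsilon>\<close> of the current
iterate.
\<close>
lemma ascent_gain: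
  assumes steep: "2 * M * \<epsilon> \<le> norm (gradient f (X k))"
  shows "f (X k) + (1 - 2 * \<beta>) * \<epsilon> * norm (gradient f (X k)) - M * \<epsilon>\<^sup>2 \<le> f (X (Suc k))"
proof -
  let ?z = "X k"
  let ?g = "gradient f (X k)"
  define a where "a = (1 - \<beta>) * \<epsilon>"
  define q where "q = ?z + a *\<^sub>R sgn ?g"
  have gpos: "0 < norm ?g" using steep M_pos eps_pos by (smt (verit) mult_pos_pos)
  have a: "0 \<le> a" "a \<le> \<epsilon>" using beta eps_pos by (auto simp: a_def mult_le_cancel_right1)
  have sg: "sgn ?g \<bullet> ?g = norm ?g"
    using gpos by (simp add: sgn_div_norm dot_square_norm power2_eq_square)
  have nq: "norm (q - ?z) = a" using gpos a by (simp add: q_def norm_sgn)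
  have "q \<in> upper_level_set f s"
  proof -
    have "a * (M * a) \<le> a * norm ?g"
    proof (rule mult_left_mono)
      have "M * a \<le> M * \<epsilon>" using a M_pos by simp
      moreover have "0 \<le> M * \<epsilon>" using M_pos eps_pos by simp
      ultimately show "M * a \<le> norm ?g" using steep by linarith
    qed (rule a)
    moreover have "(q - ?z) \<bullet> ?g = a * norm ?g" using sg by (simp add: q_def)
    moreover have "M * (norm (q - ?z))\<^sup>2 = a * (M * a)" unfolding nq by (simp add: power2_eq_square)
    ultimately have "f ?z \<le> f q" using taylor[of q ?z] by linarith
    then show ?thesis using X_level[of k] by (simp add: upper_level_set_def)
  qed
  then obtain y where y: "y \<in> Y" "norm (q - y) \<le> \<beta> * \<epsilon>" using covering by blast
  have near: "norm (y - ?z) \<le> \<epsilon>"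
    using norm_triangle_ineq4[of "q - ?z" "q - y"] nq y(2) by (simp add: a_def algebra_simps)
  have "(y - ?z) \<bullet> ?g = a * norm ?g - (q - y) \<bullet> ?g"
    using sg by (simp add: q_def inner_diff_left inner_add_left)
  moreover have "(q - y) \<bullet> ?g \<le> \<beta> * \<epsilon> * norm ?g"
    using Cauchy_Schwarz_ineq2[of "q - y" ?g] mult_right_mono[OF y(2), of "norm ?g"] by simp
  moreover have "M * (norm (y - ?z))\<^sup>2 \<le> M * \<epsilon>\<^sup>2"
    using near M_pos by (intro mult_left_mono power_mono) auto
  ultimately have "f ?z + (a * norm ?g - \<beta> * \<epsilon> * norm ?g) - M * \<epsilon>\<^sup>2 \<le> f y"
    using taylor[of y ?z] by linarith
  then show ?thesis using X_max[OF y(1) near] by (simp add: a_def algebra_simps)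
qed

lemma stop_imp_small_gradient:
  assumes "f (X (Suc k)) = f (X k)"
  shows "norm (gradient f (X k)) < 2 * M * \<epsilon>"
proof (rule ccontr)
  assume "\<not> ?thesis"
  then have *: "2 * M * \<epsilon> \<le> norm (gradient f (X k))" by simp
  have "3 / 4 * \<epsilon> * (2 * M * \<epsilon>) \<le> (1 - 2 * \<beta>) * \<epsilon> * norm (gradient f (X k))"
    using beta eps_pos M_pos * by (intro mult_mono mult_right_mono) auto
  then have "M * \<epsilon>\<^sup>2 / 2 \<le> 0" using ascent_gain[OF *] assms by (simp add: power2_eq_square)
  then show False using M_pos eps_pos by (simp add: mult_le_0_iff)
qed

text \<open>
The gain and the Taylor bound force the inner product of the step with the unit gradient to be
nearly \<open>\<epsilon>\<close>. As the step has length at most \<open>\<epsilon>\<close>, it is then close to \<open>\<epsilon>\<close> times the unit gradient.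
\<close>
lemma step_direction:
  assumes c: "0 < c" "2 * M * \<epsilon> \<le> c" "c \<le> norm (gradient f (X k))"
    and \<delta>: "0 \<le> \<delta>" "4 * \<beta> + 4 * M * \<epsilon> / c \<le> \<delta>\<^sup>2"
  shows "norm (X (Suc k) - X k - \<epsilon> *\<^sub>R sgn (gradient f (X k))) \<le> \<epsilon> * \<delta>"
proof -
  let ?g = "gradient f (X k)"
  define D where "D = X (Suc k) - X k"
  have gpos: "0 < norm ?g" using c by linarith
  have D2: "(norm D)\<^sup>2 \<le> \<epsilon>\<^sup>2" using X_step[of k] by (auto simp: D_def intro: power_mono)
  have "M * (norm D)\<^sup>2 \<le> M * \<epsilon>\<^sup>2" using D2 M_pos by (intro mult_left_mono) auto
  then have "(1 - 2 * \<beta>) * \<epsilon> * norm ?g - 2 * M * \<epsilon>\<^sup>2 \<le> D \<bullet> ?g"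
    using ascent_gain[of k] c taylor[of "X (Suc k)" "X k"] unfolding D_def by linarith
  then have "((1 - 2 * \<beta>) * \<epsilon> * norm ?g - 2 * M * \<epsilon>\<^sup>2) / norm ?g \<le> (D \<bullet> ?g) / norm ?g"
    using gpos by (intro divide_right_mono) auto
  moreover have "D \<bullet> sgn ?g = (D \<bullet> ?g) / norm ?g"
    by (simp add: sgn_div_norm divide_inverse_commute)
  moreover have "((1 - 2 * \<beta>) * \<epsilon> * norm ?g - 2 * M * \<epsilon>\<^sup>2) / norm ?g
      = (1 - 2 * \<beta>) * \<epsilon> - 2 * M * \<epsilon>\<^sup>2 / norm ?g" using gpos by (simp add: diff_divide_distrib)
  moreover have "2 * M * \<epsilon>\<^sup>2 / norm ?g \<le> 2 * M * \<epsilon>\<^sup>2 / c"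
    using c M_pos gpos by (intro divide_left_mono) auto
  ultimately have "(1 - 2 * \<beta>) * \<epsilon> - 2 * M * \<epsilon>\<^sup>2 / c \<le> D \<bullet> sgn ?g" by linarith
  then have "2 * \<epsilon> * ((1 - 2 * \<beta>) * \<epsilon> - 2 * M * \<epsilon>\<^sup>2 / c) \<le> 2 * \<epsilon> * (D \<bullet> sgn ?g)"
    using eps_pos by (intro mult_left_mono) auto
  moreover have "(norm (D - \<epsilon> *\<^sub>R sgn ?g))\<^sup>2 = (norm D)\<^sup>2 - 2 * \<epsilon> * (D \<bullet> sgn ?g) + \<epsilon>\<^sup>2"
  proof -
    have "sgn ?g \<bullet> sgn ?g = 1" using gpos by (simp add: dot_square_norm norm_sgn)
    then show ?thesis
      unfolding power2_norm_eq_inner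
      by (simp add: inner_diff_left inner_diff_right inner_commute power2_eq_square algebra_simps)
  qed
  ultimately have "(norm (D - \<epsilon> *\<^sub>R sgn ?g))\<^sup>2 \<le> 2 * \<epsilon>\<^sup>2 - 2 * \<epsilon> * ((1 - 2 * \<beta>) * \<epsilon> - 2 * M * \<epsilon>\<^sup>2 / c)"
    using D2 by linarith
  also have "\<dots> = \<epsilon>\<^sup>2 * (4 * \<beta> + 4 * M * \<epsilon> / c)"
    by (simp add: power2_eq_square algebra_simps)
  also have "\<dots> \<le> \<epsilon>\<^sup>2 * \<delta>\<^sup>2" using \<delta> by (intro mult_left_mono) auto
  finally have "(norm (D - \<epsilon> *\<^sub>R sgn ?g))\<^sup>2 \<le> (\<epsilon> * \<delta>)\<^sup>2" by (simp add: power_mult_distrib)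
  then show ?thesis unfolding D_def by (rule power2_le_imp_le) (use eps_pos \<delta> in simp)
qed

text \<open>
Without a stop \<open>f\<close> would increase strictly along infinitely many medoids in a bounded set.
\<close>
lemma terminates: "\<exists>k. f (X (Suc k)) = f (X k)"
proof (rule ccontr)
  assume "\<nexists>k. f (X (Suc k)) = f (X k)"
  then have "f (X (Suc k)) < f (X (Suc (Suc k)))" for k
    using X_mono[of "Suc k"] by (metis less_eq_real_def zero_less_Suc)
  then have "strict_mono (\<lambda>k. f (X (Suc k)))" by (simp add: strict_mono_Suc_iff)
  then have "inj (\<lambda>k. f (X (Suc k)))" by (rule strict_mono_imp_inj_on)
  then have "inj (\<lambda>k. X (Suc k))" by (auto simp: inj_def)
  moreover have "range (\<lambda>k. X (Suc k)) \<subseteq> Y \<inter> upper_level_set f s"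
    using X_medoid X_level by blast
  moreover have "finite (Y \<inter> upper_level_set f s)"
    using locally_finite bounded_level by (simp add: locally_finite_def)
  ultimately show False by (meson finite_subset infinite_UNIV_nat finite_imageD)
qed

text \<open>
Before the index \<open>k\<close> the gradient is too large for a stop. From \<open>Suc k\<close> on, the iterates are
medoids, so \<open>f\<close> does not decrease and the region \<open>W\<close> is never left. The stopping criterion bounds
the gradient at the last but one point; the Lipschitz bound transfers this to the limit.
\<close>
lemma converges_inside:
  assumes near: "norm (X k - p) < w" "\<And>j. j < k \<Longrightarrow> 2 * M * \<epsilon> \<le> norm (gradient f (X j))"
    and W: "ball p (w + \<epsilon>) \<subseteq> W" "\<And>x y. x \<in> W \<Longrightarrow> y \<in> cball x \<epsilon> \<Longrightarrow> f x \<le> f y \<Longrightarrow> y \<in> W"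
  obtains q where "q \<in> Y" "mms_converges_to sel f Y \<epsilon> x\<^sub>0 q" "q \<in> W"
    "norm (gradient f q) \<le> 3 * M * \<epsilon>"
proof -
  obtain K where K: "f (X (Suc K)) = f (X K)" "\<And>j. j < K \<Longrightarrow> f (X (Suc j)) \<noteq> f (X j)"
    using terminates exists_least_iff[of "\<lambda>k. f (X (Suc k)) = f (X k)"] by blast
  have "k \<le> K"
    using stop_imp_small_gradient[OF K(1)] near(2)[of K] by (meson leI not_le)
  have inW: "X (Suc k + i) \<in> W" for i
  proof (induction i)
    case 0
    have "dist p (X (Suc k)) < w + \<epsilon>"
      using near(1) X_step[of k] norm_triangle_ineq[of "X (Suc k) - X k" "X k - p"]
      by (simp add: dist_norm norm_minus_commute del: mms_iterate.simps)
    then show ?case using W(1) by auto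
  next
    case (Suc i)
    then show ?case
      using W(2)[of "X (Suc k + i)" "X (Suc (Suc k + i))"] X_mono[of "Suc k + i"] X_step[of "Suc k + i"]
      by (simp add: dist_norm norm_minus_commute del: mms_iterate.simps)
  qed
  show thesis
  proof (rule that[of "X (Suc K)"])
    show "X (Suc K) \<in> Y" by (rule X_medoid)
    show "mms_converges_to sel f Y \<epsilon> x\<^sub>0 (X (Suc K))"
      unfolding mms_converges_to_def Let_def
      using K mms_argmax_nonempty[OF X_level] by blast
    show "X (Suc K) \<in> W" using inW[of "K - k"] \<open>k \<le> K\<close> by simp
    have "norm (gradient f (X (Suc K)) - gradient f (X K)) \<le> M * \<epsilon>"
      using gradient_Lipschitz[of "X (Suc K)" "X K"] mult_left_mono[OF X_step[of K], of M] M_pos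
      by linarith
    then show "norm (gradient f (X (Suc K))) \<le> 3 * M * \<epsilon>"
      using stop_imp_small_gradient[OF K(1)] norm_triangle_sub[of "gradient f (X (Suc K))" "gradient f (X K)"]
      by linarith
  qed
qed

end

section \<open>Consequences of the hypotheses on the density\<close>

lemma GDERIV_gradient:
  fixes f :: "real ^ 'n \<Rightarrow> real"
  assumes "f differentiable (at x)"
  shows "GDERIV f x :> gradient f x"
proof -
  obtain f' where f': "(f has_derivative f') (at x)" using assms by (auto simp: differentiable_def)
  then have "f' = (\<lambda>h. h \<bullet> adjoint f' 1)"
    using adjoint_works[OF has_derivative_linear, of f f' "at x" _ 1] by auto
  then have "GDERIV f x :> adjoint f' 1" using f' unfolding gderiv_def by simp
  moreover have "v = w" if "GDERIV f x :> v" "GDERIV f x :> w" for v w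
  proof -
    have "(\<lambda>h. h \<bullet> v) = (\<lambda>h. h \<bullet> w)"
      using that unfolding gderiv_def by (rule has_derivative_unique)
    then show "v = w" by (metis vector_eq_ldot)
  qed
  ultimately show ?thesis unfolding gradient_def by (metis theI)
qed

lemma bounded_hessian_imp_Lipschitz_gradient:
  fixes f :: "real ^ 'n \<Rightarrow> real"
  assumes tw: "twice_differentiable f"
    and bg: "bounded (range (gradient f))" and bh: "bounded (range (hessian f))"
  obtains M G where "lipschitz_gradient f (gradient f) M G"
proof -
  obtain b where b: "0 < b" "\<And>x. norm (hessian f x) \<le> b"
    using bh unfolding bounded_pos by auto
  obtain G where G: "0 < G" "\<And>x. norm (gradient f x) \<le> G"
    using bg unfolding bounded_pos by auto
  define M where "M = real CARD('n) * real CARD('n) * b"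
  have "norm (gradient f x - gradient f y) \<le> M * norm (x - y)" for x y
  proof (rule differentiable_bound[where S = UNIV and f' = "\<lambda>z h. hessian f z *v h"])
    fix z
    show "(gradient f has_derivative (\<lambda>h. hessian f z *v h)) (at z within UNIV)"
      using tw unfolding twice_differentiable_def hessian_def jacobian_works by simp
    have "\<bar>hessian f z $ i $ j\<bar> \<le> b" for i j
      using component_le_norm_cart[of "hessian f z $ i" j]
        Finite_Cartesian_Product.norm_nth_le[where x = "hessian f z" and i = i] b(2)[of z]
      by linarith
    then show "onorm (\<lambda>h. hessian f z *v h) \<le> M"
      unfolding M_def by (rule onorm_le_matrix_component)
  qed auto
  moreover have "0 < M" using b by (simp add: M_def)
  moreover have "GDERIV f x :> gradient f x" for x
    using tw by (intro GDERIV_gradient) (simp add: twice_differentiable_def)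
  ultimately have "lipschitz_gradient f (gradient f) M G"
    using G by unfold_locales auto
  then show thesis by (rule that)
qed

lemma nondegenerate_zero_bounded_below:
  fixes g :: "real ^ 'n \<Rightarrow> real ^ 'n"
  assumes der: "(g has_derivative (\<lambda>h. A *v h)) (at p)" and inv: "invertible A" and zero: "g p = 0"
  obtains c r where "0 < c" "0 < r" "\<And>x. x \<in> ball p r \<Longrightarrow> c * norm (x - p) \<le> norm (g x)"
proof -
  have "inj ((*v) A)" using inv by (simp add: inj_matrix_vector_mult)
  then obtain b where b: "0 < b" "\<And>h. b * norm h \<le> norm (A *v h)"
    using linear_inj_bounded_below_pos[of "(*v) A"] by auto
  have "\<exists>r>0. \<forall>x. norm (x - p) < r \<longrightarrow> norm (g x - g p - A *v (x - p)) \<le> b / 2 * norm (x - p)"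
    using der b(1) unfolding has_derivative_at_alt by (meson half_gt_zero)
  then obtain r where r: "0 < r"
    "\<And>x. norm (x - p) < r \<Longrightarrow> norm (g x - g p - A *v (x - p)) \<le> b / 2 * norm (x - p)" by blast
  show thesis
  proof (rule that[of "b / 2" r])
    fix x assume "x \<in> ball p r"
    then have "norm (g x - A *v (x - p)) \<le> b / 2 * norm (x - p)"
      using r(2)[of x] zero by (simp add: dist_norm norm_minus_commute)
    moreover have "norm (A *v (x - p)) \<le> norm (g x) + norm (g x - A *v (x - p))"
      using norm_triangle_ineq4[of "g x" "g x - A *v (x - p)"] by simp
    ultimately show "b / 2 * norm (x - p) \<le> norm (g x)" using b(2)[of "x - p"] by simp
  qed (use b r in auto)
qed

lemma bounded_upper_level_set:
  fixes f :: "'a::real_normed_vector \<Rightarrow> real"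
  assumes "(f \<longlongrightarrow> 0) at_infinity" "0 < s"
  shows "bounded (upper_level_set f s)"
proof -
  have "\<forall>\<^sub>F x in at_infinity. f x < s" using assms by (rule order_tendstoD)
  then obtain b where "\<And>x. b \<le> norm x \<Longrightarrow> f x < s" unfolding eventually_at_infinity by blast
  then show ?thesis unfolding bounded_iff upper_level_set_def
    by (intro exI[of _ b]) (auto simp: not_le[symmetric] intro: leI)
qed

lemma eventually_mult_less_at_right_0: "0 < a \<Longrightarrow> \<forall>\<^sub>F \<tau> in at_right 0. K * \<tau> < (a::real)"
  using order_tendstoD(2)[OF tendsto_mult_left[OF tendsto_ident_at], of K 0 a] by simp

section \<open>Consistency\<close>

text \<open>
In this form the density of the medoid set enters only through the covering condition, and the
limit point is within \<open>C * \<epsilon>\<close> of the mode: it lies in the trapping region, where the distance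
to the mode is bounded by a multiple of the gradient, and the gradient there is of order \<open>\<epsilon>\<close>.
\<close>
lemma mms_consistent:
  fixes f :: "real ^ 'n \<Rightarrow> real"
  assumes lim: "(f \<longlongrightarrow> 0) at_infinity" and tw: "twice_differentiable f"
    and bg: "bounded (range (gradient f))" and bh: "bounded (range (hessian f))"
    and nondeg: "\<And>x. critical_point f x \<Longrightarrow> invertible (hessian f x)"
    and s: "0 < s" and mode: "is_mode f p" and start: "2 * s \<le> f x\<^sub>0"
    and basin: "x\<^sub>0 \<in> basin_of_attraction f p"
  obtains C \<tau> where "0 < C" "0 < \<tau>"
    "\<And>Y \<epsilon> sel. locally_finite Y \<Longrightarrow> tie_breaking_rule sel \<Longrightarrow> 0 < \<epsilon> \<Longrightarrow> \<epsilon> \<le> \<tau> \<Longrightarrow>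
       (\<And>x. x \<in> upper_level_set f s \<Longrightarrow> \<exists>y\<in>Y. norm (x - y) \<le> \<tau> * \<epsilon>) \<Longrightarrow>
       \<exists>q\<in>Y. mms_converges_to sel f Y \<epsilon> x\<^sub>0 q \<and> norm (q - p) \<le> C * \<epsilon>"
proof -
  obtain M G where "lipschitz_gradient f (gradient f) M G"
    using bounded_hessian_imp_Lipschitz_gradient[OF tw bg bh] .
  then interpret lipschitz_gradient f "gradient f" M G .
  obtain r0 where r0: "0 < r0" "\<And>y. y \<in> ball p r0 \<Longrightarrow> f y \<le> f p"
    using mode unfolding is_mode_def by blast
  have crit: "gradient f p = 0" using r0 by (rule local_max_critical)
  have "(gradient f has_derivative (\<lambda>h. hessian f p *v h)) (at p)"
    using tw unfolding twice_differentiable_def hessian_def jacobian_works by simp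
  then obtain b r1 where b: "0 < b" "0 < r1"
    "\<And>x. x \<in> ball p r1 \<Longrightarrow> b * norm (x - p) \<le> norm (gradient f x)"
    using nondegenerate_zero_bounded_below[of "gradient f" "hessian f p" p] nondeg[of p] crit
    unfolding critical_point_def by blast
  obtain W e where W: "open W" "p \<in> W" "0 < e" "W \<subseteq> ball p r1"
    "\<And>x y. x \<in> W \<Longrightarrow> y \<in> cball x e \<Longrightarrow> f x \<le> f y \<Longrightarrow> y \<in> W"
    using trapping_region[OF r0 b] by metis
  obtain w where w: "0 < w" "ball p w \<subseteq> W" using W openE by blast
  obtain \<gamma> where \<gamma>: "gradient_flow_line f x\<^sub>0 \<gamma>" "(\<gamma> \<longlongrightarrow> p) at_top"
    using basin unfolding basin_of_attraction_def by blast
  have ode: "(\<gamma> has_vector_derivative gradient f (\<gamma> t)) (at t within {0..})" if "0 \<le> t" for t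
    using \<gamma>(1) that by (simp add: gradient_flow_line_def)
  have w2: "0 < w / 2" using w by simp
  obtain c \<delta> \<tau>1 where c: "0 < c" "0 < \<delta>" "0 < \<tau>1"
    "\<And>\<epsilon> x. 0 < \<epsilon> \<Longrightarrow> \<epsilon> \<le> \<tau>1 \<Longrightarrow> x 0 = \<gamma> 0 \<Longrightarrow>
       (\<And>k. c \<le> norm (gradient f (x k)) \<Longrightarrow>
          norm (x (Suc k) - x k - \<epsilon> *\<^sub>R sgn (gradient f (x k))) \<le> \<epsilon> * \<delta>) \<Longrightarrow>
       \<exists>k. norm (x k - p) < w / 2 \<and> (\<forall>j<k. c \<le> norm (gradient f (x j)))"
    using normalized_ascent_reaches_limit[OF ode \<gamma>(2) w2] by metis
  \<comment> \<open>Each bound is of the form \<open>K * \<tau> < a\<close> with \<open>K \<ge> 0\<close>, so it persists for all smaller \<open>\<epsilon>\<close>.\<close>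
  have "\<forall>\<^sub>F \<tau> in at_right 0. 0 < \<tau> \<and> 1 * \<tau> < \<tau>1 \<and> 1 * \<tau> < e \<and> 1 * \<tau> < w / 2 \<and> 1 * \<tau> < 1 / 8 \<and>
      G * \<tau> < s \<and> 2 * M * \<tau> < c \<and> (4 + 4 * M / c) * \<tau> < \<delta>\<^sup>2"
    using c W w2 s by (intro eventually_conj eventually_at_right_less eventually_mult_less_at_right_0) auto
  then obtain \<tau> where \<tau>: "0 < \<tau>" "\<tau> < \<tau>1" "\<tau> < e" "\<tau> < w / 2" "\<tau> < 1 / 8"
      "G * \<tau> < s" "2 * M * \<tau> < c" "(4 + 4 * M / c) * \<tau> < \<delta>\<^sup>2"
    using eventually_happens'[OF trivial_limit_at_right_real] by auto
  show thesis
  proof (rule that[of "3 * M / b" \<tau>])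
    fix Y :: "(real ^ 'n) set" and \<epsilon> :: real
      and sel :: "real ^ 'n \<Rightarrow> (real ^ 'n) set \<Rightarrow> real ^ 'n"
    assume Y: "locally_finite Y" "tie_breaking_rule sel" and \<epsilon>: "0 < \<epsilon>" "\<epsilon> \<le> \<tau>"
      and cov: "\<And>x. x \<in> upper_level_set f s \<Longrightarrow> \<exists>y\<in>Y. norm (x - y) \<le> \<tau> * \<epsilon>"
    have G\<epsilon>: "G * \<epsilon> \<le> G * \<tau>" and M\<epsilon>: "2 * M * \<epsilon> \<le> 2 * M * \<tau>" and Mc: "4 * M / c * \<epsilon> \<le> 4 * M / c * \<tau>"
      using \<epsilon> G_pos M_pos c by (auto intro: mult_left_mono divide_right_mono)
    interpret mms_run f M G Y sel \<epsilon> \<tau> s x\<^sub>0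
      using Y \<epsilon> cov \<tau> G\<epsilon> start bounded_upper_level_set[OF lim s] by unfold_locales auto
    have step: "norm (X (Suc k) - X k - \<epsilon> *\<^sub>R sgn (gradient f (X k))) \<le> \<epsilon> * \<delta>"
      if "c \<le> norm (gradient f (X k))" for k
    proof (rule step_direction[OF c(1) _ that])
      show "4 * \<tau> + 4 * M * \<epsilon> / c \<le> \<delta>\<^sup>2"
        using \<tau>(8) Mc by (simp add: distrib_right)
    qed (use M\<epsilon> \<tau> c in auto)
    have "\<exists>k. norm (X k - p) < w / 2 \<and> (\<forall>j<k. c \<le> norm (gradient f (X j)))"
      by (rule c(4)[OF \<epsilon>(1)]) (use \<epsilon> \<tau> \<gamma> step in
          \<open>auto simp: gradient_flow_line_def simp del: mms_iterate.simps(2)\<close>)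
    then obtain k where k: "norm (X k - p) < w / 2" "\<And>j. j < k \<Longrightarrow> c \<le> norm (gradient f (X j))" by blast
    have "2 * M * \<epsilon> \<le> norm (gradient f (X j))" if "j < k" for j
      using k(2)[OF that] M\<epsilon> \<tau> by linarith
    moreover have "ball p (w / 2 + \<epsilon>) \<subseteq> W" using w \<epsilon> \<tau> by fastforce
    moreover have "y \<in> W" if "x \<in> W" "y \<in> cball x \<epsilon>" "f x \<le> f y" for x y
      using W(5)[of x y] that \<epsilon> \<tau> by simp
    ultimately obtain q where q: "q \<in> Y" "mms_converges_to sel f Y \<epsilon> x\<^sub>0 q" "q \<in> W"
        "norm (gradient f q) \<le> 3 * M * \<epsilon>"
      using converges_inside[OF k(1), of W] by blast
    have "b * norm (q - p) \<le> 3 * M * \<epsilon>" using b(3)[of q] q W(4) by force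
    then have "norm (q - p) \<le> 3 * M / b * \<epsilon>" using b by (simp add: field_simps)
    then show "\<exists>q\<in>Y. mms_converges_to sel f Y \<epsilon> x\<^sub>0 q \<and> norm (q - p) \<le> 3 * M / b * \<epsilon>"
      using q by blast
  qed (use \<tau> M_pos b in auto)
qed

text \<open>
The factor 2 makes the bound strict, which yields a medoid without an attained infimum.
\<close>
lemma medoid_gap_imp_covering:
  assumes gap: "medoid_gap f s Y / ennreal \<epsilon> \<le> ennreal \<tau>" and pos: "0 < \<epsilon>" "0 < \<tau>"
    and x: "x \<in> upper_level_set f s"
  shows "\<exists>y\<in>Y. norm (x - y) \<le> 2 * \<tau> * \<epsilon>"
proof -
  have "medoid_gap f s Y / ennreal \<epsilon> < ennreal (2 * \<tau>)"
    using pos by (intro le_less_trans[OF gap]) (simp add: ennreal_less_iff)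
  then have less: "medoid_gap f s Y < ennreal (2 * \<tau> * \<epsilon>)"
    using pos by (simp add: divide_less_ennreal ennreal_mult)
  have "(INF y\<in>Y. ennreal (norm (x - y))) \<le> medoid_gap f s Y"
    using x unfolding medoid_gap_def by (rule SUP_upper)
  also note less
  finally obtain y where "y \<in> Y" "ennreal (norm (x - y)) < ennreal (2 * \<tau> * \<epsilon>)"
    unfolding INF_less_iff by blast
  then show ?thesis by (auto simp: ennreal_less_iff intro: less_imp_le)
qed

theorem mainTheorem8:
  fixes f :: "real ^ 'n \<Rightarrow> real" and s :: real and x_star x\<^sub>0 :: "real ^ 'n"
  assumes "prob_density f"
    and "(f \<longlongrightarrow> 0) at_infinity"
    and "twice_differentiable f"
    and "bounded_unif_cont f"
    and "bounded_unif_cont (gradient f)"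
    and "bounded_unif_cont (hessian f)"
    and "\<And>x. critical_point f x \<Longrightarrow> invertible (hessian f x)"
    and "s > 0"
    and "is_mode f x_star"
    and "x\<^sub>0 \<in> upper_level_set f (2 * s)"
    and "x\<^sub>0 \<in> basin_of_attraction f x_star"
  shows
    "(\<exists>C>0. \<exists>\<tau>>0. \<forall>Y \<epsilon> sel.
        locally_finite Y \<and> tie_breaking_rule sel \<and> 0 < \<epsilon> \<and> \<epsilon> \<le> \<tau> \<and>
        medoid_gap f s Y / ennreal \<epsilon> \<le> ennreal \<tau> \<longrightarrow>
        (\<exists>p\<in>Y. mms_converges_to sel f Y \<epsilon> x\<^sub>0 p \<and>
           ennreal (norm (p - x_star)) \<le> ennreal C * (medoid_gap f s Y / ennreal \<epsilon> + ennreal \<epsilon>)))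
     \<and>
     (\<forall>(Y :: nat \<Rightarrow> (real ^ 'n) set) (\<epsilon> :: nat \<Rightarrow> real) sel.
        (\<forall>n. locally_finite (Y n)) \<and> (\<forall>n. tie_breaking_rule (sel n)) \<and> (\<forall>n. 0 < \<epsilon> n) \<and>
        (\<lambda>n. medoid_gap f s (Y n)) \<longlonglongrightarrow> 0 \<and> \<epsilon> \<longlonglongrightarrow> 0 \<and>
        (\<lambda>n. medoid_gap f s (Y n) / ennreal (\<epsilon> n)) \<longlonglongrightarrow> 0 \<longrightarrow>
        (\<exists>p. (\<forall>\<^sub>F n in sequentially. mms_converges_to (sel n) f (Y n) (\<epsilon> n) x\<^sub>0 (p n)) \<and>
           p \<longlonglongrightarrow> x_star))"
proof -
  obtain C \<tau> where C: "0 < C" and \<tau>: "0 < \<tau>" and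
    covered: "\<And>Y \<epsilon> sel. locally_finite Y \<Longrightarrow> tie_breaking_rule sel \<Longrightarrow> 0 < \<epsilon> \<Longrightarrow> \<epsilon> \<le> \<tau> \<Longrightarrow>
       (\<And>x. x \<in> upper_level_set f s \<Longrightarrow> \<exists>y\<in>Y. norm (x - y) \<le> \<tau> * \<epsilon>) \<Longrightarrow>
       \<exists>q\<in>Y. mms_converges_to sel f Y \<epsilon> x\<^sub>0 q \<and> norm (q - x_star) \<le> C * \<epsilon>"
    using mms_consistent[of f s x_star x\<^sub>0] assms
    unfolding bounded_unif_cont_def upper_level_set_def by blast
  have main: "\<exists>q\<in>Y. mms_converges_to sel f Y \<epsilon> x\<^sub>0 q \<and> norm (q - x_star) \<le> C * \<epsilon>"
    if "locally_finite Y" "tie_breaking_rule sel" "0 < \<epsilon>" "\<epsilon> \<le> \<tau> / 2"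
      "medoid_gap f s Y / ennreal \<epsilon> \<le> ennreal (\<tau> / 2)" for Y \<epsilon> sel
  proof (rule covered[OF that(1,2,3)])
    show "\<epsilon> \<le> \<tau>" using that(4) \<tau> by simp
    show "\<exists>y\<in>Y. norm (x - y) \<le> \<tau> * \<epsilon>" if "x \<in> upper_level_set f s" for x
      using medoid_gap_imp_covering[OF \<open>medoid_gap f s Y / ennreal \<epsilon> \<le> ennreal (\<tau> / 2)\<close>
          \<open>0 < \<epsilon>\<close> _ that] \<tau> by simp
  qed
  show ?thesis
  proof (intro conjI allI impI)
    show "\<exists>C>0. \<exists>\<tau>>0. \<forall>Y \<epsilon> sel.
        locally_finite Y \<and> tie_breaking_rule sel \<and> 0 < \<epsilon> \<and> \<epsilon> \<le> \<tau> \<and>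
        medoid_gap f s Y / ennreal \<epsilon> \<le> ennreal \<tau> \<longrightarrow>
        (\<exists>p\<in>Y. mms_converges_to sel f Y \<epsilon> x\<^sub>0 p \<and>
           ennreal (norm (p - x_star)) \<le> ennreal C * (medoid_gap f s Y / ennreal \<epsilon> + ennreal \<epsilon>))"
    proof (rule exI[of _ C], intro conjI C, rule exI[of _ "\<tau> / 2"], intro conjI allI impI)
      show "0 < \<tau> / 2" using \<tau> by simp
      fix Y :: "(real ^ 'n) set" and \<epsilon> :: real
        and sel :: "real ^ 'n \<Rightarrow> (real ^ 'n) set \<Rightarrow> real ^ 'n"
      assume "locally_finite Y \<and> tie_breaking_rule sel \<and> 0 < \<epsilon> \<and> \<epsilon> \<le> \<tau> / 2 \<and>
        medoid_gap f s Y / ennreal \<epsilon> \<le> ennreal (\<tau> / 2)"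
      then obtain q where q: "q \<in> Y" "mms_converges_to sel f Y \<epsilon> x\<^sub>0 q" "norm (q - x_star) \<le> C * \<epsilon>"
        and "0 < \<epsilon>" using main by blast
      have "ennreal (norm (q - x_star)) \<le> ennreal C * ennreal \<epsilon>"
        using q(3) C \<open>0 < \<epsilon>\<close> by (simp add: ennreal_mult[symmetric] ennreal_leI)
      also have "\<dots> \<le> ennreal C * (medoid_gap f s Y / ennreal \<epsilon> + ennreal \<epsilon>)"
        by (intro mult_left_mono) auto
      finally show "\<exists>p\<in>Y. mms_converges_to sel f Y \<epsilon> x\<^sub>0 p \<and>
           ennreal (norm (p - x_star)) \<le> ennreal C * (medoid_gap f s Y / ennreal \<epsilon> + ennreal \<epsilon>)"
        using q by blast
    qed
  next
    fix Y :: "nat \<Rightarrow> (real ^ 'n) set" and \<epsilon> :: "nat \<Rightarrow> real"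
      and sel :: "nat \<Rightarrow> real ^ 'n \<Rightarrow> (real ^ 'n) set \<Rightarrow> real ^ 'n"
    assume *: "(\<forall>n. locally_finite (Y n)) \<and> (\<forall>n. tie_breaking_rule (sel n)) \<and> (\<forall>n. 0 < \<epsilon> n) \<and>
        (\<lambda>n. medoid_gap f s (Y n)) \<longlonglongrightarrow> 0 \<and> \<epsilon> \<longlonglongrightarrow> 0 \<and>
        (\<lambda>n. medoid_gap f s (Y n) / ennreal (\<epsilon> n)) \<longlonglongrightarrow> 0"
    let ?P = "\<lambda>n q. mms_converges_to (sel n) f (Y n) (\<epsilon> n) x\<^sub>0 q \<and> norm (q - x_star) \<le> C * \<epsilon> n"
    have "\<forall>\<^sub>F n in sequentially. \<epsilon> n < \<tau> / 2"
      using * \<tau> by (intro order_tendstoD(2)[of \<epsilon> 0]) auto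
    moreover have "\<forall>\<^sub>F n in sequentially. medoid_gap f s (Y n) / ennreal (\<epsilon> n) < ennreal (\<tau> / 2)"
      using * \<tau> by (intro order_tendstoD(2)[of _ 0]) auto
    ultimately have ev: "\<forall>\<^sub>F n in sequentially. ?P n (SOME q. ?P n q)"
    proof eventually_elim
      case (elim n)
      then have "\<exists>q. ?P n q" using main[of "Y n" "sel n" "\<epsilon> n"] * by force
      then show ?case by (rule someI_ex)
    qed
    have "(\<lambda>n. C * \<epsilon> n) \<longlonglongrightarrow> 0" using * by (auto intro: tendsto_mult_right_zero)
    then have "(\<lambda>n. (SOME q. ?P n q) - x_star) \<longlonglongrightarrow> 0"
      by (rule Lim_null_comparison[rotated]) (use ev in \<open>auto elim: eventually_mono\<close>)
    then have "(\<lambda>n. SOME q. ?P n q) \<longlonglongrightarrow> x_star" by (simp add: LIM_zero_iff)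
    then show "\<exists>p. (\<forall>\<^sub>F n in sequentially. mms_converges_to (sel n) f (Y n) (\<epsilon> n) x\<^sub>0 (p n)) \<and>
           p \<longlonglongrightarrow> x_star"
      using ev by (intro exI[of _ "\<lambda>n. SOME q. ?P n q"]) (auto elim: eventually_mono)
  qed
qed

end
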